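(* Let $q$ be a prime power, let $\sigma$ be an automorphism of $\mathbb{F}_{q^n}$ with fixed field $\mathbb{F}_q$, and let $R=\mathbb{F}_{q^n}[t;\sigma]$. Let $f,g\in R$ be irreducibles of degree $d$, with $mzlm(f)=\hat f(t^n)$ and $mzlm(g)=\hat g(t^n)$ for $\hat f,\hat g\in\mathbb{F}_q[y]$. If $$\hat g(y)=\lambda^{-d}\hat f^{\rho}(\lambda y)$$ for some $\lambda\in\mathbb{F}_q^{\times}$ and $\rho\in\mathrm{Aut}(\mathbb{F}_q)$, then $\mathbb{S}_f$ and $\mathbb{S}_g$ are isotopic.
   Context: $R=\mathbb{F}_{q^n}[t;\sigma]$ is the skew polynomial ring: polynomials in $t$ with (left) coefficients in $\mathbb{F}_{q^n}$, termwise addition, and multiplication determined by $ta=a^{\sigma}t$ for $a\in\mathbb{F}_{q^n}$. An element $f$ of positive degree is irreducible if there are no $a,b\in R$ with $\deg(a),\deg(b)<\deg(f)$ and $f=ab$. For $f\neq0$ every $a\in R$ can be written uniquely as $a=uf+v$ with $\deg(v)<\deg(f)$; write $v=a\bmod f$. For $f$ irreducible of degree $d$, $\mathbb{S}_f=(V,\circ_f)$ is the semifield on the set $V$ of elements of $R$ of degree less than $d$ with $a\circ_f b:=ab\bmod f$. The centre of $R$ is $\mathbb{F}_q[t^n;\sigma]\simeq\mathbb{F}_q[y]$ (with $t^n\mapsto y$). The minimal central left multiple $mzlm(f)$ of an irreducible $f$ is the monic polynomial of minimal degree in the centre of $R$ that is right-divisible by $f$, i.e. of the form $uf$ with $u\in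 R$; it exists, is unique, and equals $\hat f(t^n)$ with $\hat f\in\mathbb{F}_q[y]$ monic irreducible of degree $\deg(f)$ in $y$. For $\hat f\in\mathbb{F}_q[y]$, $\hat f^\rho$ is obtained by applying $\rho$ to the coefficients. Two semifields $(\mathbb{S},\circ)$, $(\hat{\mathbb{S}},\hat\circ)$ are isotopic if there is a triple $(F,G,H)$ of bijective additive (linear over the prime field) maps $\mathbb{S}\to\hat{\mathbb{S}}$ with $x^F\,\hat\circ\, y^G=(x\circ y)^H$ for all $x,y$. *)

theory Defs
  imports
    "HOL-Computational_Algebra.Polynomial"
    "HOL-Number_Theory.Prime_Powers"
begin

text \<open>
  The skew polynomial ring \<open>R = L[t;\<sigma>]\<close> over the field \<open>L\<close> with type \<^typ>\<open>'a\<close> has the additive group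
  of \<^typ>\<open>'a poly\<close>: \<open>monom a i\<close> stands for \<open>a t\<^sup>i\<close>, with coefficients on the left.
  Degree, leading coefficient and addition are those of \<^typ>\<open>'a poly\<close>. The multiplication of \<open>R\<close> is
  not the type class product but \<open>skew_mult \<sigma>\<close>, the biadditive extension of
  \<open>(a t\<^sup>i) (b t\<^sup>j) = a \<sigma>\<^sup>i(b) t\<^sup>i\<^sup>+\<^sup>j\<close>.
\<close>

definition skew_mult :: "('a::field \<Rightarrow> 'a) \<Rightarrow> 'a poly \<Rightarrow> 'a poly \<Rightarrow> 'a poly" where
  "skew_mult \<sigma> a b =
     (\<Sum>i\<le>degree a. \<Sum>j\<le>degree b. monom (coeff a i * (\<sigma> ^^ i) (coeff b j)) (i + j))"

lemma skew_mult_t_const: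
  "skew_mult \<sigma> (monom 1 1) [:a:] = monom (\<sigma> a) 1"
  by (simp add: skew_mult_def degree_monom_eq)

definition field_automorphism_on :: "'a::field set \<Rightarrow> ('a \<Rightarrow> 'a) \<Rightarrow> bool" where
  "field_automorphism_on K \<rho> \<longleftrightarrow>
     bij_betw \<rho> K K \<and> \<rho> 1 = 1 \<and>
     (\<forall>x\<in>K. \<forall>y\<in>K. \<rho> (x + y) = \<rho> x + \<rho> y \<and> \<rho> (x * y) = \<rho> x * \<rho> y)"

definition fixed_field :: "('a::field \<Rightarrow> 'a) \<Rightarrow> 'a set" where
  "fixed_field \<sigma> = {x. \<sigma> x = x}"

definition polys_over :: "'a::field set \<Rightarrow> 'a poly set" where
  "polys_over K = {p. \<forall>i. coeff p i \<in> K}"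

definition skew_irreducible :: "('a::field \<Rightarrow> 'a) \<Rightarrow> 'a poly \<Rightarrow> bool" where
  "skew_irreducible \<sigma> f \<longleftrightarrow>
     degree f > 0 \<and>
     \<not> (\<exists>a b. degree a < degree f \<and> degree b < degree f \<and> f = skew_mult \<sigma> a b)"

text \<open>
  Remainder of right division by \<open>f \<noteq> 0\<close>. The disjunct \<open>v = 0\<close> accounts for the zero polynomial,
  which has degree \<open>0\<close> in the library.
\<close>

definition skew_mod :: "('a::field \<Rightarrow> 'a) \<Rightarrow> 'a poly \<Rightarrow> 'a poly \<Rightarrow> 'a poly" where
  "skew_mod \<sigma> a f =
     (THE v. (v = 0 \<or> degree v < degree f) \<and> (\<exists>u. a = skew_mult \<sigma> u f + v))"

definition skew_semifield ::
    "('a::field \<Rightarrow> 'a) \<Rightarrow> 'a poly \<Rightarrow> 'a poly set \<times> ('a poly \<Rightarrow> 'a poly \<Rightarrow> 'a poly)" where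
  "skew_semifield \<sigma> f =
     ({a. a = 0 \<or> degree a < degree f}, \<lambda>a b. skew_mod \<sigma> (skew_mult \<sigma> a b) f)"

definition skew_centre :: "('a::field \<Rightarrow> 'a) \<Rightarrow> 'a poly set" where
  "skew_centre \<sigma> = {z. \<forall>a. skew_mult \<sigma> z a = skew_mult \<sigma> a z}"

definition skew_right_dvd :: "('a::field \<Rightarrow> 'a) \<Rightarrow> 'a poly \<Rightarrow> 'a poly \<Rightarrow> bool" where
  "skew_right_dvd \<sigma> f z \<longleftrightarrow> (\<exists>u. z = skew_mult \<sigma> u f)"

text \<open>\<open>is_mzlm \<sigma> f m\<close>: the minimal central left multiple of \<open>f\<close> is \<open>m\<close>.\<close>

definition is_mzlm :: "('a::field \<Rightarrow> 'a) \<Rightarrow> 'a poly \<Rightarrow> 'a poly \<Rightarrow> bool" where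
  "is_mzlm \<sigma> f m \<longleftrightarrow>
     m \<in> skew_centre \<sigma> \<and> lead_coeff m = 1 \<and> skew_right_dvd \<sigma> f m \<and>
     (\<forall>z\<in>skew_centre \<sigma>. lead_coeff z = 1 \<and> skew_right_dvd \<sigma> f z \<longrightarrow> degree m \<le> degree z)"

text \<open>
  \<open>eval_t_power n p\<close> is \<open>p(t\<^sup>n) = \<Sum>\<^sub>i p\<^sub>i t\<^sup>n\<^sup>i\<close>, as an element of \<open>R\<close>.
\<close>

definition eval_t_power :: "nat \<Rightarrow> 'a::field poly \<Rightarrow> 'a poly" where
  "eval_t_power n p = (\<Sum>i\<le>degree p. monom (coeff p i) (n * i))"

text \<open>
  A semifield is given by its underlying additive group, as a subset of an abelian group type,
  and its multiplication.
\<close>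

definition additive_on :: "'b::ab_group_add set \<Rightarrow> ('b \<Rightarrow> 'c::ab_group_add) \<Rightarrow> bool" where
  "additive_on A F \<longleftrightarrow> (\<forall>x\<in>A. \<forall>y\<in>A. F (x + y) = F x + F y)"

definition isotopic ::
    "'b::ab_group_add set \<times> ('b \<Rightarrow> 'b \<Rightarrow> 'b) \<Rightarrow>
     'c::ab_group_add set \<times> ('c \<Rightarrow> 'c \<Rightarrow> 'c) \<Rightarrow> bool" where
  "isotopic S T \<longleftrightarrow>
     (\<exists>F G H.
        bij_betw F (fst S) (fst T) \<and> bij_betw G (fst S) (fst T) \<and> bij_betw H (fst S) (fst T) \<and>
        additive_on (fst S) F \<and> additive_on (fst S) G \<and> additive_on (fst S) H \<and>
        (\<forall>x\<in>fst S. \<forall>y\<in>fst S. snd T (F x) (G y) = H (snd S x y)))"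

end

theory Submission
  imports "HOL-Number_Theory.Residues" Defs
begin

text \<open>
Write \<open>L\<close> for the finite field on which \<open>\<sigma>\<close> acts and \<open>F\<close> for its fixed field, so that \<open>L\<close> has degree
\<open>n\<close> over \<open>F\<close>. The isotopism is the composite of two.

The first comes from an automorphism of the ring \<open>R = L[t;\<sigma>]\<close>. Every automorphism of \<open>F\<close> is a power of
the Frobenius map of \<open>F\<close>, so \<open>\<rho>\<close> extends to a power \<open>\<tau>\<close> of the Frobenius map of \<open>L\<close>, which
commutes with \<open>\<sigma>\<close> (\<open>extend_automorphism\<close>). The norm from \<open>L\<close> to \<open>F\<close> is surjective, so \<open>\<lambda>\<close> is the norm of
some \<open>\<mu>\<close> (\<open>field_norm_surjective\<close>). Then \<open>\<tau>\<close> on the coefficients together with \<open>t \<mapsto> \<mu> t\<close> defines an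
automorphism \<open>\<phi>\<close> of \<open>R\<close>. It carries \<open>\<S>\<^sub>f\<close> isomorphically to the semifield of \<open>\<phi>(f)\<close>
(\<open>isotopic_phi\<close>), and it maps \<open>t\<^sup>n\<close> to \<open>\<lambda> t\<^sup>n\<close>. Up to the constant \<open>\<lambda>\<^sup>d\<close> it therefore maps
the minimal central left multiple of \<open>f\<close> to that of \<open>g\<close>, so that \<open>\<phi>(f)\<close> is a right divisor
of the latter.

The second isotopism joins two irreducibles \<open>f\<close>, \<open>g\<close> of equal degree such that \<open>f\<close> is a right divisor of
the minimal central left multiple \<open>m\<close> of \<open>g\<close> (\<open>isotopic_if_common_central_multiple\<close>). Write
\<open>m = u f\<close>; as \<open>m\<close> is central, also \<open>m = f u\<close>, so \<open>f\<close> annihilates the image of \<open>u R\<close> in the simple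
module \<open>R/Rg\<close>. This image is nonzero: otherwise \<open>u\<close> lies in the annihilator of \<open>R/Rg\<close>, a
two-sided ideal, whose monic element of least degree is central unless \<open>t\<close> divides it, and a central
element there of degree below that of \<open>m\<close> contradicts the minimality of \<open>m\<close>. (Divisibility by \<open>t\<close> is
possible only when \<open>g\<close> has degree 1, and then both semifields are the field \<open>L\<close>.) So there is \<open>w\<close> outside
\<open>Rg\<close> with \<open>f w\<close> in \<open>Rg\<close>, and right multiplication by \<open>w\<close> is an isomorphism from \<open>R/Rf\<close> to \<open>R/Rg\<close>.
On remainders this is an additive bijection \<open>H\<close> with \<open>x \<circ>\<^sub>g H(y) = H(x \<circ>\<^sub>f y)\<close>, so that
\<open>(id, H, H)\<close> is an isotopism.
\<close>

section \<open>Polynomials and additive maps\<close>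

lemma monom_induct [case_names monom add]:
  assumes "\<And>c i. P (monom c i)" and "\<And>p q. P p \<Longrightarrow> P q \<Longrightarrow> P (p + q)"
  shows "P (p :: 'a::comm_monoid_add poly)"
proof -
  have "P (\<Sum>i\<in>I. monom (coeff p i) i)" if "finite I" for I
    using that by (induction I rule: finite_induct) (use assms(1)[of 0 0] assms in auto)
  from this[of "{..degree p}"] show ?thesis by (simp add: poly_as_sum_of_monoms)
qed

lemma field_automorphism_on_UNIV_simps:
  assumes "field_automorphism_on UNIV \<tau>"
  shows "\<tau> (x + y) = \<tau> x + \<tau> y" "\<tau> (x * y) = \<tau> x * \<tau> y" "\<tau> 1 = 1" "\<tau> 0 = 0" "bij \<tau>"
    "\<tau> x = 0 \<longleftrightarrow> x = 0"
proof -
  show *: "\<tau> (x + y) = \<tau> x + \<tau> y" "\<tau> (x * y) = \<tau> x * \<tau> y" "\<tau> 1 = 1" "bij \<tau>" for x y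
    using assms by (auto simp: field_automorphism_on_def)
  show 0: "\<tau> 0 = 0" using *(1)[of 0 0] by (metis add_cancel_right_left add_0)
  show "\<tau> x = 0 \<longleftrightarrow> x = 0" using *(4) 0 by (metis bij_pointE)
qed

lemma map_poly_hom_mult:
  assumes "h 0 = 0" "\<And>x y. h (x + y) = h x + h y" "\<And>x y. h (x * y) = h x * h y"
  shows "map_poly h (p * q) = map_poly h p * map_poly h (q :: 'a::comm_ring_1 poly)"
proof -
  have sum: "h (\<Sum>i\<in>A. k i) = (\<Sum>i\<in>A. h (k i))" for A and k :: "nat \<Rightarrow> 'a"
    by (induction A rule: infinite_finite_induct) (simp_all add: assms)
  show ?thesis
    by (rule poly_eqI) (simp add: coeff_map_poly coeff_mult sum assms)
qed

lemma finite_degree_less: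
  assumes "finite (UNIV :: 'a::zero set)"
  shows "finite {a :: 'a poly. a = 0 \<or> degree a < d}" (is "finite ?V")
proof (rule finite_imageD)
  let ?c = "\<lambda>a. map (coeff a) [0..<d]"
  show "finite (?c ` ?V)"
    by (rule finite_subset[OF _ finite_lists_length_eq[OF assms, of d]]) auto
  show "inj_on ?c ?V"
  proof (rule inj_onI, rule poly_eqI)
    fix a b :: "'a poly" and i
    assume "a \<in> ?V" "b \<in> ?V" and "?c a = ?c b"
    then show "coeff a i = coeff b i"
      by (cases "i < d") (auto simp: coeff_eq_0)
  qed
qed

section \<open>Isotopisms\<close>

lemma isotopicI:
  assumes "bij_betw F (fst S) (fst T)" "bij_betw G (fst S) (fst T)" "bij_betw H (fst S) (fst T)"
    and "additive_on (fst S) F" "additive_on (fst S) G" "additive_on (fst S) H"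
    and "\<And>x y. x \<in> fst S \<Longrightarrow> y \<in> fst S \<Longrightarrow> snd T (F x) (G y) = H (snd S x y)"
  shows "isotopic S T"
  unfolding isotopic_def using assms by blast

lemma isotopic_trans:
  assumes "isotopic S T" "isotopic T U"
  shows "isotopic S U"
proof -
  from assms(1) obtain F G H where 1:
    "bij_betw F (fst S) (fst T)" "bij_betw G (fst S) (fst T)" "bij_betw H (fst S) (fst T)"
    "additive_on (fst S) F" "additive_on (fst S) G" "additive_on (fst S) H"
    "\<forall>x\<in>fst S. \<forall>y\<in>fst S. snd T (F x) (G y) = H (snd S x y)"
    unfolding isotopic_def by blast
  from assms(2) obtain F' G' H' where 2:
    "bij_betw F' (fst T) (fst U)" "bij_betw G' (fst T) (fst U)" "bij_betw H' (fst T) (fst U)"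
    "additive_on (fst T) F'" "additive_on (fst T) G'" "additive_on (fst T) H'"
    "\<forall>x\<in>fst T. \<forall>y\<in>fst T. snd U (F' x) (G' y) = H' (snd T x y)"
    unfolding isotopic_def by blast
  have "additive_on (fst S) (P' \<circ> P)"
    if "additive_on (fst S) P" "additive_on (fst T) P'" "bij_betw P (fst S) (fst T)" for P P'
    using that bij_betwE[OF that(3)] by (simp add: additive_on_def)
  moreover have "snd U ((F' \<circ> F) x) ((G' \<circ> G) y) = (H' \<circ> H) (snd S x y)"
    if "x \<in> fst S" "y \<in> fst S" for x y
    using that 1(7) 2(7) bij_betwE[OF 1(1)] bij_betwE[OF 1(2)] by simp
  ultimately show ?thesis
    using 1 2 bij_betw_trans
    by (intro isotopicI[where F = "F' \<circ> F" and G = "G' \<circ> G" and H = "H' \<circ> H"]) blast+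
qed

section \<open>Arithmetic of skew polynomials\<close>

locale skew_polynomial_ring =
  fixes \<sigma> :: "'a::field \<Rightarrow> 'a"
  assumes automorphism: "field_automorphism_on UNIV \<sigma>"
begin

abbreviation mult :: "'a poly \<Rightarrow> 'a poly \<Rightarrow> 'a poly" (infixl \<open>\<star>\<close> 70)
  where "a \<star> b \<equiv> skew_mult \<sigma> a b"

abbreviation in_left_ideal :: "'a poly \<Rightarrow> 'a poly \<Rightarrow> bool" (infix \<open>rdvd\<close> 50)
  where "f rdvd a \<equiv> skew_right_dvd \<sigma> f a"

lemmas sigma_simps [simp] = field_automorphism_on_UNIV_simps[OF automorphism]

lemma sigma_power_0 [simp]: "(\<sigma> ^^ i) 0 = 0"
  and sigma_power_1 [simp]: "(\<sigma> ^^ i) 1 = 1"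
  and sigma_power_add [simp]: "(\<sigma> ^^ i) (x + y) = (\<sigma> ^^ i) x + (\<sigma> ^^ i) y"
  and sigma_power_mult [simp]: "(\<sigma> ^^ i) (x * y) = (\<sigma> ^^ i) x * (\<sigma> ^^ i) y"
  by (induction i) auto

lemma bij_sigma_power: "bij (\<sigma> ^^ i)"
  by (simp add: sigma_simps(5) bij_betw_funpow)

lemma sigma_power_eq_0_iff [simp]: "(\<sigma> ^^ i) x = 0 \<longleftrightarrow> x = 0"
  using bij_sigma_power[of i] by (metis bij_pointE sigma_power_0)

text \<open>
The convolution formula no longer mentions the degrees of the factors, which makes
biadditivity immediate.
\<close>

lemma coeff_skew_mult: "coeff (a \<star> b) k = (\<Sum>i\<le>k. coeff a i * (\<sigma> ^^ i) (coeff b (k - i)))"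
proof -
  have inner: "(\<Sum>j\<le>degree b. coeff (monom (coeff a i * (\<sigma> ^^ i) (coeff b j)) (i + j)) k)
      = (if i \<le> k then coeff a i * (\<sigma> ^^ i) (coeff b (k - i)) else 0)" for i
  proof -
    have "(\<Sum>j\<le>degree b. coeff (monom (coeff a i * (\<sigma> ^^ i) (coeff b j)) (i + j)) k)
        = (\<Sum>j\<le>degree b. if j = k - i \<and> i \<le> k then coeff a i * (\<sigma> ^^ i) (coeff b (k - i)) else 0)"
      by (intro sum.cong) auto
    then show ?thesis
      by (auto simp: not_le coeff_eq_0)
  qed
  have "coeff (a \<star> b) k = (\<Sum>i\<le>degree a. if i \<le> k then coeff a i * (\<sigma> ^^ i) (coeff b (k - i)) else 0)"
    by (simp only: skew_mult_def coeff_sum inner)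
  also have "\<dots> = (\<Sum>i\<in>{..degree a} \<inter> {..k}. coeff a i * (\<sigma> ^^ i) (coeff b (k - i)))"
    by (subst sum.inter_restrict) auto
  also have "\<dots> = (\<Sum>i\<le>k. coeff a i * (\<sigma> ^^ i) (coeff b (k - i)))"
    by (rule sum.mono_neutral_left) (auto simp: coeff_eq_0)
  finally show ?thesis .
qed

lemma add_skew_mult: "(a + b) \<star> c = a \<star> c + b \<star> c"
  by (rule poly_eqI) (simp add: coeff_skew_mult distrib_right sum.distrib)

lemma skew_mult_add: "a \<star> (b + c) = a \<star> b + a \<star> c"
  by (rule poly_eqI) (simp add: coeff_skew_mult distrib_left sum.distrib)

lemma zero_skew_mult [simp]: "0 \<star> a = 0"
  and skew_mult_zero [simp]: "a \<star> 0 = 0"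
  by (simp_all add: skew_mult_def)

lemma diff_skew_mult: "(a - b) \<star> c = a \<star> c - b \<star> c"
  by (metis add_diff_cancel add_skew_mult diff_add_cancel)

lemma skew_mult_diff: "a \<star> (b - c) = a \<star> b - a \<star> c"
  by (metis add_diff_cancel skew_mult_add diff_add_cancel)

lemma monom_skew_mult_monom: "monom a i \<star> monom b j = monom (a * (\<sigma> ^^ i) b) (i + j)"
proof (rule poly_eqI)
  fix k
  have "coeff (monom a i \<star> monom b j) k
      = (\<Sum>l\<le>k. if l = i then a * (\<sigma> ^^ i) (coeff (monom b j) (k - i)) else 0)"
    unfolding coeff_skew_mult by (intro sum.cong) auto
  then show "coeff (monom a i \<star> monom b j) k = coeff (monom (a * (\<sigma> ^^ i) b) (i + j)) k"
    by auto
qed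

text \<open>
All three arguments enter additively, so it is enough to compare products of monomials.
\<close>

lemma skew_mult_assoc: "a \<star> b \<star> c = a \<star> (b \<star> c)"
proof (induction a rule: monom_induct)
  case (monom x i)
  show ?case
  proof (induction b rule: monom_induct)
    case (monom y j)
    show ?case
      by (induction c rule: monom_induct)
        (simp_all add: monom_skew_mult_monom skew_mult_add funpow_add mult.assoc add.assoc)
  qed (simp add: skew_mult_add add_skew_mult)
qed (simp add: add_skew_mult)

lemma const_skew_mult: "[:c:] \<star> a = smult c a"
  by (rule poly_eqI) (simp add: coeff_skew_mult coeff_pCons sum.atMost_shift)

lemma one_skew_mult [simp]: "1 \<star> a = a"
  using const_skew_mult[of 1 a] by (simp add: one_pCons)

lemma skew_mult_one [simp]: "a \<star> 1 = a"
  by (induction a rule: monom_induct)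
    (simp_all add: add_skew_mult monom_skew_mult_monom flip: monom_0 one_pCons monom_eq_1)

lemma smult_skew_mult: "smult c a \<star> b = smult c (a \<star> b)"
  by (metis const_skew_mult skew_mult_assoc)

lemma coeff_skew_mult_degree_sum:
  "coeff (a \<star> b) (degree a + degree b) = lead_coeff a * (\<sigma> ^^ degree a) (lead_coeff b)"
proof -
  have "coeff (a \<star> b) (degree a + degree b)
      = (\<Sum>i\<in>{degree a}. coeff a i * (\<sigma> ^^ i) (coeff b (degree a + degree b - i)))"
    unfolding coeff_skew_mult
  proof (rule sum.mono_neutral_right)
    show "\<forall>i\<in>{..degree a + degree b} - {degree a}.
        coeff a i * (\<sigma> ^^ i) (coeff b (degree a + degree b - i)) = 0"
    proof
      fix i assume "i \<in> {..degree a + degree b} - {degree a}"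
      then have "i > degree a \<or> degree a + degree b - i > degree b" by auto
      then show "coeff a i * (\<sigma> ^^ i) (coeff b (degree a + degree b - i)) = 0"
        by (auto simp: coeff_eq_0)
    qed
  qed auto
  then show ?thesis by simp
qed

lemma degree_skew_mult:
  assumes "a \<noteq> 0" "b \<noteq> 0"
  shows "degree (a \<star> b) = degree a + degree b"
proof (rule antisym)
  show "degree (a \<star> b) \<le> degree a + degree b"
  proof (rule degree_le, intro allI impI)
    fix k assume k: "degree a + degree b < k"
    have "coeff a i * (\<sigma> ^^ i) (coeff b (k - i)) = 0" for i
    proof -
      have "degree a < i \<or> degree b < k - i" using k by auto
      then show ?thesis by (auto simp: coeff_eq_0)
    qed
    then show "coeff (a \<star> b) k = 0" by (simp only: coeff_skew_mult sum.neutral_const)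
  qed
  show "degree a + degree b \<le> degree (a \<star> b)"
    by (rule le_degree) (simp add: coeff_skew_mult_degree_sum assms)
qed

lemma skew_mult_eq_0_iff [simp]: "a \<star> b = 0 \<longleftrightarrow> a = 0 \<or> b = 0"
  by (metis coeff_0 coeff_skew_mult_degree_sum leading_coeff_0_iff mult_eq_0_iff skew_mult_zero
      sigma_power_eq_0_iff zero_skew_mult)

lemma skew_mult_right_cancel: "c \<noteq> 0 \<Longrightarrow> a \<star> c = b \<star> c \<Longrightarrow> a = b"
  by (metis diff_skew_mult eq_iff_diff_eq_0 skew_mult_eq_0_iff)

section \<open>Left ideals and remainders\<close>

lemma rdvd_refl [simp]: "f rdvd f"
  unfolding skew_right_dvd_def by (metis one_skew_mult)
lemma rdvd_0 [simp]: "f rdvd 0"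
  unfolding skew_right_dvd_def by (metis zero_skew_mult)
lemma rdvd_add: "f rdvd a \<Longrightarrow> f rdvd b \<Longrightarrow> f rdvd a + b"
  unfolding skew_right_dvd_def by (metis add_skew_mult)
lemma rdvd_diff: "f rdvd a \<Longrightarrow> f rdvd b \<Longrightarrow> f rdvd a - b"
  unfolding skew_right_dvd_def by (metis diff_skew_mult)
lemma rdvd_mult: "f rdvd a \<Longrightarrow> f rdvd b \<star> a"
  unfolding skew_right_dvd_def by (metis skew_mult_assoc)

lemma rdvd_degree: "f rdvd a \<Longrightarrow> a \<noteq> 0 \<Longrightarrow> degree f \<le> degree a"
  unfolding skew_right_dvd_def using degree_skew_mult by force

lemma right_division:
  assumes "f \<noteq> 0"
  shows "\<exists>u v. a = u \<star> f + v \<and> (v = 0 \<or> degree v < degree f)"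
proof (induction "degree a" arbitrary: a rule: less_induct)
  case less
  show ?case
  proof (cases "a = 0 \<or> degree a < degree f")
    case True
    then show ?thesis by (intro exI[of _ 0] exI[of _ a]) auto
  next
    case False
    define k where "k = degree a - degree f"
    define c where "c = monom (lead_coeff a / (\<sigma> ^^ k) (lead_coeff f)) k"
    have c: "c \<noteq> 0" "degree c = k"
      using False assms by (auto simp: c_def degree_monom_eq)
    have deg: "degree (c \<star> f) = degree a"
      using False c assms by (simp add: degree_skew_mult k_def)
    have lc: "lead_coeff (c \<star> f) = lead_coeff a"
      using coeff_skew_mult_degree_sum[of c f] c assms False
      by (simp add: degree_skew_mult) (simp add: c_def)
    have "a - c \<star> f = 0 \<or> degree (a - c \<star> f) < degree a"
      by (metis deg lc degree_diff_le eq_zero_or_degree_less coeff_diff order_refl right_minus_eq)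
    then obtain u v where "a - c \<star> f = u \<star> f + v" "v = 0 \<or> degree v < degree f"
      using less.hyps[of "a - c \<star> f"] by (metis add.right_neutral zero_skew_mult)
    then show ?thesis
      by (intro exI[of _ "c + u"] exI[of _ v]) (auto simp: add_skew_mult algebra_simps)
  qed
qed

text \<open>
The remainder is the unique representative of small degree of a class modulo the left ideal
\<open>Rf\<close>. Every later computation with remainders is a congruence modulo this ideal.
\<close>

lemma skew_mod_unique:
  assumes "f rdvd a - v" "v = 0 \<or> degree v < degree f"
  shows "skew_mod \<sigma> a f = v"
  unfolding skew_mod_def
proof (rule the_equality)
  from assms show "(v = 0 \<or> degree v < degree f) \<and> (\<exists>u. a = u \<star> f + v)"
    unfolding skew_right_dvd_def by (metis diff_add_cancel)
  fix w assume w: "(w = 0 \<or> degree w < degree f) \<and> (\<exists>u. a = u \<star> f + w)"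
  then have "f rdvd a - w" unfolding skew_right_dvd_def by (metis add_diff_cancel)
  then have "f rdvd w - v" using rdvd_diff[OF assms(1), of "a - w"] by simp
  moreover have "w - v = 0 \<or> degree (w - v) < degree f"
    using w assms(2) degree_diff_less[of w "degree f" v] by auto
  ultimately show "w = v" using rdvd_degree by fastforce
qed

lemma skew_mod_properties:
  assumes "f \<noteq> 0"
  shows rdvd_minus_skew_mod: "f rdvd a - skew_mod \<sigma> a f"
    and degree_skew_mod: "skew_mod \<sigma> a f = 0 \<or> degree (skew_mod \<sigma> a f) < degree f"
proof -
  obtain u v where uv: "a = u \<star> f + v" "v = 0 \<or> degree v < degree f"
    using right_division[OF assms] by blast
  then have d: "f rdvd a - v" unfolding skew_right_dvd_def by auto
  from skew_mod_unique[OF d uv(2)] d uv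
  show "f rdvd a - skew_mod \<sigma> a f" "skew_mod \<sigma> a f = 0 \<or> degree (skew_mod \<sigma> a f) < degree f"
    by auto
qed

lemma skew_mod_cong: "f \<noteq> 0 \<Longrightarrow> f rdvd a - b \<Longrightarrow> skew_mod \<sigma> a f = skew_mod \<sigma> b f"
  using rdvd_add[OF _ rdvd_minus_skew_mod[of f b], of "a - b"] degree_skew_mod[of f b]
  by (intro skew_mod_unique) auto

lemma skew_mod_add: "f \<noteq> 0 \<Longrightarrow> skew_mod \<sigma> (a + b) f = skew_mod \<sigma> a f + skew_mod \<sigma> b f"
proof (intro skew_mod_unique)
  assume f: "f \<noteq> 0"
  show "f rdvd a + b - (skew_mod \<sigma> a f + skew_mod \<sigma> b f)"
    using rdvd_add[OF rdvd_minus_skew_mod[OF f, of a] rdvd_minus_skew_mod[OF f, of b]]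
    by (simp add: algebra_simps)
  show "skew_mod \<sigma> a f + skew_mod \<sigma> b f = 0 \<or> degree (skew_mod \<sigma> a f + skew_mod \<sigma> b f) < degree f"
    using degree_skew_mod[OF f, of a] degree_skew_mod[OF f, of b] by (auto intro: degree_add_less)
qed

text \<open>
The left ideal generated by an irreducible element is maximal: \<open>R\<close> is a left principal ideal domain, and a
generator of \<open>J\<close> would be a right factor of \<open>f\<close> of smaller degree, hence a unit.
\<close>

lemma irreducible_generates_with:
  assumes f: "skew_irreducible \<sigma> f" and x: "x \<noteq> 0" "degree x < degree f"
    and J: "\<And>a b. a \<in> J \<Longrightarrow> b \<in> J \<Longrightarrow> a - b \<in> J" "\<And>r a. a \<in> J \<Longrightarrow> r \<star> a \<in> J"
    and fJ: "f \<in> J" and xJ: "x \<in> J"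
  shows "1 \<in> J"
proof -
  obtain h where h: "h \<in> J" "h \<noteq> 0" and min: "\<And>y. y \<in> J \<Longrightarrow> y \<noteq> 0 \<Longrightarrow> degree h \<le> degree y"
    using ex_has_least_nat[of "\<lambda>y. y \<in> J \<and> y \<noteq> 0" x degree] x xJ by blast
  obtain s v where sv: "f = s \<star> h + v" "v = 0 \<or> degree v < degree h"
    using right_division[OF h(2)] by blast
  have "v = f - s \<star> h" using sv by simp
  then have "v \<in> J" using J fJ h by auto
  then have v: "v = 0" using sv min by fastforce
  have hf: "degree h < degree f" using min[OF xJ x(1)] x by simp
  then have "s \<noteq> 0" "\<not> degree s < degree f" using f sv v by (auto simp: skew_irreducible_def)
  then have "degree h = 0" using sv v h degree_skew_mult[of s h] by auto
  then obtain c where c: "h = [:c:]" by (meson degree_eq_zeroE)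
  then have "[:inverse c:] \<star> h = 1" using h by (simp add: const_skew_mult one_pCons)
  then show ?thesis using J h by metis
qed

lemma skew_mod_small: "a = 0 \<or> degree a < degree f \<Longrightarrow> skew_mod \<sigma> a f = a"
  by (rule skew_mod_unique) auto

lemma skew_mod_eq_iff: "f \<noteq> 0 \<Longrightarrow> skew_mod \<sigma> a f = skew_mod \<sigma> b f \<longleftrightarrow> f rdvd a - b"
  using rdvd_diff[OF rdvd_minus_skew_mod[of f a] rdvd_minus_skew_mod[of f b]] skew_mod_cong
  by auto

section \<open>Irreducible right divisors of a central element\<close>

text \<open>
The elements are constants, whose products need no reduction: both semifields are the coefficient field.
\<close>

lemma isotopic_degree_1:
  assumes "degree f = 1" "degree g = 1"
  shows "isotopic (skew_semifield \<sigma> f) (skew_semifield \<sigma> g)"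
proof -
  have "skew_mod \<sigma> (x \<star> y) h = x \<star> y" if "degree h = 1" "degree x = 0" "degree y = 0" for x y h
    using that degree_skew_mult[of x y]
    by (intro skew_mod_small) (cases "x = 0"; cases "y = 0"; simp)
  moreover have "skew_mod \<sigma> 0 h = 0" for h by (simp add: skew_mod_small)
  ultimately show ?thesis
    using assms unfolding skew_semifield_def
    by (intro isotopicI[where F = id and G = id and H = id]) (auto simp: additive_on_def)
qed

text \<open>
The element \<open>w\<close> represents a nonzero homomorphism \<open>R/Rf \<rightarrow> R/Rg\<close>, \<open>x \<mapsto> x w\<close>. It is injective because \<open>Rf\<close>
is a maximal left ideal, and bijective because the coefficient field is finite.
\<close>

lemma isotopic_if_intertwined:
  assumes finite: "finite (UNIV :: 'a set)"
    and f: "skew_irreducible \<sigma> f" and g: "skew_irreducible \<sigma> g" and deg: "degree g = degree f"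
    and w: "g rdvd f \<star> w" "\<not> g rdvd w"
  shows "isotopic (skew_semifield \<sigma> f) (skew_semifield \<sigma> g)"
proof -
  define V where "V = {a :: 'a poly. a = 0 \<or> degree a < degree f}"
  define H where "H x = skew_mod \<sigma> (x \<star> w) g" for x
  have f0: "f \<noteq> 0" and g0: "g \<noteq> 0" using f g by (auto simp: skew_irreducible_def)
  have diff_V: "x - y \<in> V" if "x \<in> V" "y \<in> V" for x y
    using that degree_diff_less[of x "degree f" y] by (auto simp: V_def)
  have "inj_on H V"
  proof (rule inj_onI, rule ccontr)
    fix x y assume xy: "x \<in> V" "y \<in> V" "H x = H y" "x \<noteq> y"
    define J where "J = {r. g rdvd r \<star> w}"
    have "1 \<in> J"
    proof (rule irreducible_generates_with[OF f, of "x - y"])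
      show "x - y \<noteq> 0" "degree (x - y) < degree f" using diff_V[OF xy(1,2)] xy by (auto simp: V_def)
      show "x - y \<in> J" using xy(3) g0 by (simp add: J_def H_def skew_mod_eq_iff diff_skew_mult)
    qed (use w in \<open>auto simp: J_def diff_skew_mult skew_mult_assoc intro: rdvd_diff rdvd_mult\<close>)
    then show False using w(2) by (simp add: J_def)
  qed
  moreover have "H ` V \<subseteq> V"
    using degree_skew_mod[OF g0] deg by (auto simp: H_def V_def)
  moreover have "finite V"
    unfolding V_def by (rule finite_degree_less[OF finite])
  ultimately have bij: "bij_betw H V V"
    by (simp add: bij_betw_def endo_inj_surj)
  have hom: "skew_mod \<sigma> (x \<star> H y) g = H (skew_mod \<sigma> (x \<star> y) f)" for x y
  proof -
    have "g rdvd x \<star> (y \<star> w) - x \<star> H y"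
      using rdvd_mult[OF rdvd_minus_skew_mod[OF g0]] by (simp add: H_def flip: skew_mult_diff)
    moreover have "g rdvd x \<star> (y \<star> w) - skew_mod \<sigma> (x \<star> y) f \<star> w"
    proof -
      obtain u where u: "x \<star> y - skew_mod \<sigma> (x \<star> y) f = u \<star> f"
        using rdvd_minus_skew_mod[OF f0] unfolding skew_right_dvd_def by blast
      have "x \<star> (y \<star> w) - skew_mod \<sigma> (x \<star> y) f \<star> w = u \<star> (f \<star> w)"
        by (simp flip: skew_mult_assoc diff_skew_mult u)
      then show ?thesis using w(1) rdvd_mult by simp
    qed
    ultimately have "g rdvd (x \<star> (y \<star> w) - skew_mod \<sigma> (x \<star> y) f \<star> w) - (x \<star> (y \<star> w) - x \<star> H y)"
      by (rule rdvd_diff[rotated])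
    then show ?thesis by (simp add: H_def[of "skew_mod \<sigma> (x \<star> y) f"] skew_mod_eq_iff[OF g0])
  qed
  have "additive_on V H"
    using g0 by (simp add: additive_on_def H_def add_skew_mult skew_mod_add)
  moreover have "additive_on V id" by (simp add: additive_on_def)
  moreover have "skew_semifield \<sigma> f = (V, \<lambda>a b. skew_mod \<sigma> (a \<star> b) f)"
    "skew_semifield \<sigma> g = (V, \<lambda>a b. skew_mod \<sigma> (a \<star> b) g)"
    by (simp_all add: skew_semifield_def V_def deg)
  ultimately show ?thesis
    using bij hom by (intro isotopicI[where F = id and G = H and H = H]) simp_all
qed

abbreviation t :: "'a poly" where "t \<equiv> monom 1 (Suc 0)"

lemma t_skew_mult: "t \<star> p = pCons 0 (map_poly \<sigma> p)"
proof (induction p rule: monom_induct)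
  case (add p q)
  have "map_poly \<sigma> (p + q) = map_poly \<sigma> p + map_poly \<sigma> q"
    by (rule poly_eqI) (simp add: coeff_map_poly)
  with add show ?case by (simp add: skew_mult_add)
qed (simp add: monom_skew_mult_monom map_poly_monom flip: monom_Suc)

lemma skew_mult_t: "p \<star> t = pCons 0 p"
  by (induction p rule: monom_induct)
    (simp_all add: monom_skew_mult_monom add_skew_mult flip: monom_Suc)

lemma in_centre_if_commutes_with_generators:
  assumes const: "\<And>a. z \<star> [:a:] = [:a:] \<star> z" and t: "z \<star> t = t \<star> z"
  shows "z \<in> skew_centre \<sigma>"
proof -
  have "z \<star> monom a i = monom a i \<star> z" for a i
  proof (induction i)
    case (Suc i)
    have "monom a (Suc i) = monom a i \<star> t" by (simp add: monom_skew_mult_monom)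
    then show ?case using Suc t by (metis skew_mult_assoc)
  qed (use const in \<open>simp add: monom_0\<close>)
  then have "z \<star> a = a \<star> z" for a
    by (induction a rule: monom_induct) (simp_all add: skew_mult_add add_skew_mult)
  then show ?thesis by (simp add: skew_centre_def)
qed

text \<open>
If \<open>z\<close> has degree \<open>k\<close>, then \<open>z a - \<sigma>\<^sup>k(a) z\<close> lies in the ideal and has degree below \<open>k\<close>, so it vanishes,
and \<open>z t - t z\<close> lies in the ideal and has degree at most \<open>k\<close>, so it is a multiple \<open>c z\<close>. Comparing the
constant coefficients, where that of \<open>z\<close> is nonzero, gives \<open>\<sigma>\<^sup>k(a) = a\<close> and \<open>c = 0\<close>.
\<close>

lemma ideal_generator_central:
  assumes I: "\<And>a b. a \<in> I \<Longrightarrow> b \<in> I \<Longrightarrow> a - b \<in> I"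
      "\<And>r a. a \<in> I \<Longrightarrow> r \<star> a \<in> I" "\<And>r a. a \<in> I \<Longrightarrow> a \<star> r \<in> I"
    and z: "z \<in> I" "lead_coeff z = 1" "coeff z 0 \<noteq> 0"
    and min: "\<And>y. y \<in> I \<Longrightarrow> y \<noteq> 0 \<Longrightarrow> degree z \<le> degree y"
  shows "z \<in> skew_centre \<sigma>"
proof (rule in_centre_if_commutes_with_generators)
  let ?k = "degree z"
  have vanish: "y = 0" if "y \<in> I" "degree y \<le> ?k" "coeff y ?k = 0" for y
    using that min[of y] by (metis eq_zero_or_degree_less leD le_neq_implies_less leading_coeff_0_iff)
  fix a
  have "degree (z \<star> [:b:]) \<le> ?k" "degree ([:b:] \<star> z) \<le> ?k" for b
    using degree_skew_mult[of z "[:b:]"] degree_skew_mult[of "[:b:]" z] by (cases "b = 0"; cases "z = 0"; simp)+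
  moreover have coeff_z: "coeff (z \<star> [:a:]) i = coeff z i * (\<sigma> ^^ i) a" for i
  proof -
    have "coeff (z \<star> [:a:]) i = (\<Sum>j\<in>{i}. coeff z j * (\<sigma> ^^ j) (coeff [:a:] (i - j)))"
      unfolding coeff_skew_mult by (rule sum.mono_neutral_right) (auto simp: coeff_pCons split: nat.splits)
    then show ?thesis by simp
  qed
  ultimately have eq: "z \<star> [:a:] - [:(\<sigma> ^^ ?k) a:] \<star> z = 0"
    by (intro vanish I z degree_diff_le) (simp_all add: const_skew_mult z)
  have "(\<sigma> ^^ ?k) a = a"
    using arg_cong[OF eq, of "\<lambda>p. coeff p 0"] z(3) by (simp add: coeff_z const_skew_mult)
  then show "z \<star> [:a:] = [:a:] \<star> z" using eq by simp
next
  let ?k = "degree z"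
  define y where "y = z \<star> t - t \<star> z"
  have yI: "y \<in> I" using I z by (simp add: y_def)
  have y0: "coeff y 0 = 0" by (simp add: y_def skew_mult_t t_skew_mult)
  have ydeg: "degree y \<le> ?k"
  proof (rule degree_le, intro allI impI)
    fix i assume "?k < i"
    then show "coeff y i = 0"
      using z(2) by (cases "i = Suc ?k")
        (auto simp: y_def skew_mult_t t_skew_mult coeff_pCons coeff_map_poly coeff_eq_0 split: nat.splits)
  qed
  have "y - [:coeff y ?k:] \<star> z \<in> I" using yI I z by simp
  moreover have "degree (y - [:coeff y ?k:] \<star> z) \<le> ?k"
    using ydeg by (intro degree_diff_le) (auto simp: const_skew_mult)
  moreover have "coeff (y - [:coeff y ?k:] \<star> z) ?k = 0" using z by (simp add: const_skew_mult)
  ultimately have "y - [:coeff y ?k:] \<star> z = 0"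
    using min by (metis eq_zero_or_degree_less leD le_neq_implies_less leading_coeff_0_iff)
  then have eq: "y = smult (coeff y ?k) z" by (simp add: const_skew_mult)
  then have "coeff y ?k * coeff z 0 = 0" using y0 by (metis coeff_smult)
  then have "y = 0" using z(3) eq by simp
  then show "z \<star> t = t \<star> z" by (simp add: y_def)
qed

text \<open>
If no such \<open>w\<close> exists, then \<open>f w \<in> Rg\<close> implies \<open>w \<in> Rg\<close>. From \<open>f u = m\<close> it follows that \<open>u\<close> lies in
the annihilator \<open>I\<close> of \<open>R/Rg\<close>. A monic \<open>z\<close> of least degree in \<open>I\<close> with nonzero constant coefficient
would be a central left multiple of \<open>g\<close> of degree below that of \<open>m\<close>. If instead \<open>z = t z\<^sub>2\<close>, then \<open>t\<close>
kills a nonzero element of the simple module \<open>R/Rg\<close>; since \<open>t R = R t\<close>, it kills the whole module, so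
that \<open>g\<close> divides \<open>t\<close>.
\<close>

lemma intertwiner_exists:
  assumes f: "skew_irreducible \<sigma> f" and g: "skew_irreducible \<sigma> g" and deg: "degree g \<noteq> 1"
    and m: "is_mzlm \<sigma> g m" and fm: "f rdvd m"
  shows "\<exists>w. g rdvd f \<star> w \<and> \<not> g rdvd w"
proof (rule ccontr)
  assume "\<not> ?thesis"
  then have no: "g rdvd w" if "g rdvd f \<star> w" for w using that by blast
  have f0: "f \<noteq> 0" "degree f > 0" and g0: "g \<noteq> 0" "degree g > 0"
    using f g by (auto simp: skew_irreducible_def)
  have central: "m \<star> r = r \<star> m" for r
    using m by (simp add: is_mzlm_def skew_centre_def)
  have lc: "lead_coeff m = 1" and gm: "g rdvd m"
    using m by (auto simp: is_mzlm_def skew_centre_def)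
  have m0: "m \<noteq> 0" using lc by auto
  obtain u where u: "m = u \<star> f" using fm by (auto simp: skew_right_dvd_def)
  (* m is central, so f u f = f m = m f, and f cancels on the right *)
  have fu: "f \<star> u = m"
  proof (rule skew_mult_right_cancel[OF f0(1)])
    show "f \<star> u \<star> f = m \<star> f" by (metis skew_mult_assoc central u)
  qed
  (* the annihilator of R/Rg *)
  define I where "I = {z. \<forall>r. g rdvd z \<star> r}"
  have I: "\<And>a b. a \<in> I \<Longrightarrow> b \<in> I \<Longrightarrow> a - b \<in> I"
      "\<And>r a. a \<in> I \<Longrightarrow> r \<star> a \<in> I" "\<And>r a. a \<in> I \<Longrightarrow> a \<star> r \<in> I"
    by (auto simp: I_def diff_skew_mult skew_mult_assoc intro: rdvd_diff rdvd_mult)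
  have uI: "u \<in> I"
    unfolding I_def
  proof (intro CollectI allI)
    fix r
    have "f \<star> (u \<star> r) = r \<star> m" by (metis fu central skew_mult_assoc)
    then have "g rdvd f \<star> (u \<star> r)" using rdvd_mult[OF gm] by simp
    then show "g rdvd u \<star> r" by (rule no)
  qed
  have u0: "u \<noteq> 0" using u m0 by auto
  obtain z' where z': "z' \<in> I" "z' \<noteq> 0" and min': "\<And>y. y \<in> I \<Longrightarrow> y \<noteq> 0 \<Longrightarrow> degree z' \<le> degree y"
    using ex_has_least_nat[of "\<lambda>y. y \<in> I \<and> y \<noteq> 0" u degree] u0 uI by blast
  define z where "z = smult (inverse (lead_coeff z')) z'"
  have z: "z \<in> I" "lead_coeff z = 1" and min: "\<And>y. y \<in> I \<Longrightarrow> y \<noteq> 0 \<Longrightarrow> degree z \<le> degree y"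
    using z' min' I(2)[OF z'(1), of "[:inverse (lead_coeff z'):]"] by (auto simp: z_def const_skew_mult)
  have z0: "z \<noteq> 0" using z by auto
  show False
  proof (cases "coeff z 0 = 0")
    case False
    have "z \<in> skew_centre \<sigma>" by (rule ideal_generator_central[OF I z False min])
    moreover have "g rdvd z" using z(1) by (metis (mono_tags) I_def mem_Collect_eq skew_mult_one)
    ultimately have "degree m \<le> degree z" using m z(2) by (simp add: is_mzlm_def)
    also have "\<dots> \<le> degree u" using min uI u0 by blast
    also have "\<dots> < degree m" using u u0 f0 degree_skew_mult by simp
    finally show False by simp
  next
    case True
    obtain z1 where z1: "z = pCons 0 z1" using True by (cases z) auto
    (* moving t to the other side of z1 costs an application of the inverse of \<sigma> *)
    define z2 where "z2 = map_poly (inv_into UNIV \<sigma>) z1"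
    have inv0: "inv_into UNIV \<sigma> 0 = 0" by (metis sigma_simps(4,5) bij_inv_eq_iff)
    have tz2: "t \<star> z2 = z"
      using sigma_simps(5) inv0
      by (auto simp: t_skew_mult z1 z2_def map_poly_map_poly o_def surj_f_inv_f bij_is_surj)
    have "z2 \<noteq> 0" "degree z2 < degree z"
      using tz2 z0 degree_skew_mult[of t z2] by (auto simp: degree_monom_eq)
    then have "z2 \<notin> I" using min by fastforce
    then obtain r where r: "\<not> g rdvd z2 \<star> r" by (auto simp: I_def)
    (* the left ideal of the elements whose class modulo Rg is killed by t *)
    define J where "J = {s. g rdvd t \<star> s}"
    have J_mult: "s \<star> a \<in> J" if "a \<in> J" for s a
    proof -
      have "t \<star> (s \<star> a) = map_poly \<sigma> s \<star> (t \<star> a)"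
        by (metis skew_mult_t t_skew_mult skew_mult_assoc)
      then show ?thesis using that rdvd_mult by (simp add: J_def)
    qed
    have J_diff: "a - b \<in> J" if "a \<in> J" "b \<in> J" for a b
      using that by (simp add: J_def skew_mult_diff rdvd_diff)
    have gJ: "g \<in> J" by (simp add: J_def rdvd_mult)
    have wJ: "z2 \<star> r \<in> J" using z(1) by (simp add: J_def I_def tz2 flip: skew_mult_assoc)
    have "1 \<in> J"
    proof (rule irreducible_generates_with[OF g _ _ J_diff J_mult gJ])
      let ?x = "skew_mod \<sigma> (z2 \<star> r) g"
      have d: "g rdvd z2 \<star> r - ?x" by (rule rdvd_minus_skew_mod[OF g0(1)])
      show "?x \<noteq> 0" using d r by auto
      then show "degree ?x < degree g" using degree_skew_mod[OF g0(1)] by blast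
      obtain s where "z2 \<star> r - ?x = s \<star> g" using d unfolding skew_right_dvd_def by blast
      then have "?x = z2 \<star> r - s \<star> g" by (simp add: algebra_simps)
      then show "?x \<in> J" using J_diff J_mult gJ wJ by simp
    qed auto
    then have "g rdvd t" by (simp add: J_def)
    then have "degree g \<le> 1" using rdvd_degree by (fastforce simp: degree_monom_eq)
    then show False using g0 deg by simp
  qed
qed

lemma isotopic_if_common_central_multiple:
  assumes finite: "finite (UNIV :: 'a set)"
    and f: "skew_irreducible \<sigma> f" and g: "skew_irreducible \<sigma> g" and deg: "degree g = degree f"
    and m: "is_mzlm \<sigma> g m" and fm: "f rdvd m"
  shows "isotopic (skew_semifield \<sigma> f) (skew_semifield \<sigma> g)"
proof (cases "degree g = 1")
  case True
  then show ?thesis using deg by (intro isotopic_degree_1) simp_all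
next
  case False
  then obtain w where "g rdvd f \<star> w" "\<not> g rdvd w"
    using intertwiner_exists[OF f g _ m fm] by blast
  then show ?thesis by (rule isotopic_if_intertwined[OF finite f g deg])
qed

end

section \<open>Automorphisms of the skew polynomial ring\<close>

text \<open>
The data of a ring automorphism \<open>\<phi>\<close> of \<open>L[t;\<sigma>]\<close> that extends \<open>\<tau>\<close> and maps \<open>t\<close> to \<open>\<mu> t\<close>: the relation
\<open>t a = \<sigma>(a) t\<close> is preserved because \<open>\<tau>\<close> and \<open>\<sigma>\<close> commute.
\<close>

locale skew_ring_automorphism = skew_polynomial_ring +
  fixes \<tau> :: "'a \<Rightarrow> 'a" and \<mu> :: 'a
  assumes tau_automorphism: "field_automorphism_on UNIV \<tau>"
    and tau_sigma: "\<tau> (\<sigma> x) = \<sigma> (\<tau> x)"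
    and mu_nonzero: "\<mu> \<noteq> 0"
begin

lemmas tau_simps [simp] = field_automorphism_on_UNIV_simps[OF tau_automorphism]

text \<open>
The coefficient in \<open>(\<mu> t)\<^sup>i = \<mu> \<sigma>(\<mu>) \<dots> \<sigma>\<^sup>i\<^sup>-\<^sup>1(\<mu>) t\<^sup>i\<close>; if \<open>i\<close> is the degree
of \<open>L\<close> over the fixed field of \<open>\<sigma>\<close>, it is the norm of \<open>\<mu>\<close>.
\<close>

definition partial_norm :: "nat \<Rightarrow> 'a" where
  "partial_norm i = (\<Prod>j<i. (\<sigma> ^^ j) \<mu>)"

lemma partial_norm_nonzero [simp]: "partial_norm i \<noteq> 0"
  by (simp add: partial_norm_def mu_nonzero)

lemma sigma_power_prod: "(\<sigma> ^^ i) (\<Prod>j\<in>A. h j) = (\<Prod>j\<in>A. (\<sigma> ^^ i) (h j))"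
  by (induction A rule: infinite_finite_induct) auto

lemma partial_norm_add: "partial_norm (i + j) = partial_norm i * (\<sigma> ^^ i) (partial_norm j)"
proof (induction j)
  case (Suc j)
  then show ?case
    by (simp add: partial_norm_def sigma_power_prod funpow_add mult.assoc)
qed (simp add: partial_norm_def)

definition \<phi> :: "'a poly \<Rightarrow> 'a poly" where
  "\<phi> p = (\<Sum>i\<le>degree p. monom (\<tau> (coeff p i) * partial_norm i) i)"

lemma coeff_phi: "coeff (\<phi> p) i = \<tau> (coeff p i) * partial_norm i"
  by (auto simp: \<phi>_def coeff_sum not_le coeff_eq_0)

lemma phi_add: "\<phi> (p + q) = \<phi> p + \<phi> q"
  by (rule poly_eqI) (simp add: coeff_phi distrib_right)

lemma phi_monom: "\<phi> (monom a i) = monom (\<tau> a * partial_norm i) i"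
  by (rule poly_eqI) (simp add: coeff_phi)

lemma phi_0 [simp]: "\<phi> 0 = 0"
  by (rule poly_eqI) (simp add: coeff_phi)

lemma tau_sigma_power: "\<tau> ((\<sigma> ^^ i) x) = (\<sigma> ^^ i) (\<tau> x)"
  by (induction i) (simp_all add: tau_sigma)

lemma phi_mult: "\<phi> (p \<star> q) = \<phi> p \<star> \<phi> q"
proof (induction p rule: monom_induct)
  case (monom a i)
  show ?case
    by (induction q rule: monom_induct)
      (simp_all add: skew_mult_add phi_add phi_monom monom_skew_mult_monom partial_norm_add
        tau_sigma_power mult_ac)
qed (simp add: add_skew_mult phi_add)

lemma phi_eq_0_iff [simp]: "\<phi> p = 0 \<longleftrightarrow> p = 0"
  by (simp add: poly_eq_iff coeff_phi)

lemma degree_phi [simp]: "degree (\<phi> p) = degree p"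
proof -
  have "coeff (\<phi> p) i = 0 \<longleftrightarrow> coeff p i = 0" for i
    by (simp add: coeff_phi)
  then show ?thesis by (simp add: degree_def)
qed

lemma phi_diff: "\<phi> (p - q) = \<phi> p - \<phi> q"
  by (metis add_diff_cancel diff_add_cancel phi_add)

lemma bij_phi: "bij \<phi>"
proof (rule bijI)
  show "inj \<phi>"
    by (rule injI) (metis eq_iff_diff_eq_0 phi_diff phi_eq_0_iff)
  show "surj \<phi>"
  proof (rule surjI)
    fix q
    define p where "p = (\<Sum>i\<le>degree q. monom (inv_into UNIV \<tau> (coeff q i / partial_norm i)) i)"
    have "inv_into UNIV \<tau> 0 = 0" by (metis tau_simps(4,5) bij_inv_eq_iff)
    then have "coeff p i = inv_into UNIV \<tau> (coeff q i / partial_norm i)" for i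
      by (auto simp: p_def coeff_sum not_le coeff_eq_0)
    then have "\<phi> p = q"
      by (intro poly_eqI) (simp add: coeff_phi surj_f_inv_f bij_is_surj)
    then show "\<phi> ((\<lambda>q. \<Sum>i\<le>degree q. monom (inv_into UNIV \<tau> (coeff q i / partial_norm i)) i) q) = q"
      by (simp add: p_def)
  qed
qed

lemma phi_irreducible:
  assumes "skew_irreducible \<sigma> f"
  shows "skew_irreducible \<sigma> (\<phi> f)"
  unfolding skew_irreducible_def
proof (intro conjI notI)
  show "0 < degree (\<phi> f)" using assms by (simp add: skew_irreducible_def)
  assume "\<exists>a b. degree a < degree (\<phi> f) \<and> degree b < degree (\<phi> f) \<and> \<phi> f = a \<star> b"
  then obtain a b where ab: "degree a < degree f" "degree b < degree f" "\<phi> f = a \<star> b" by auto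
  obtain a' b' where "a = \<phi> a'" "b = \<phi> b'" using bij_phi by (meson bij_pointE)
  with ab have "f = a' \<star> b'" "degree a' < degree f" "degree b' < degree f"
    using bij_phi by (auto simp flip: phi_mult simp: bij_def inj_eq)
  then show False using assms by (auto simp: skew_irreducible_def)
qed

lemma isotopic_phi:
  assumes "f \<noteq> 0"
  shows "isotopic (skew_semifield \<sigma> f) (skew_semifield \<sigma> (\<phi> f))"
proof -
  define V where "V = {a :: 'a poly. a = 0 \<or> degree a < degree f}"
  have "\<phi> ` V = V"
  proof
    show "V \<subseteq> \<phi> ` V"
    proof
      fix y assume "y \<in> V"
      moreover obtain x where "y = \<phi> x" using bij_phi by (meson bij_pointE)
      ultimately show "y \<in> \<phi> ` V" by (auto simp: V_def)
    qed
  qed (auto simp: V_def)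
  then have bij: "bij_betw \<phi> V V"
    using bij_phi by (metis bij_betw_def bij_def inj_on_subset subset_UNIV)
  have hom: "skew_mod \<sigma> (\<phi> x \<star> \<phi> y) (\<phi> f) = \<phi> (skew_mod \<sigma> (x \<star> y) f)" for x y
  proof (rule skew_mod_unique)
    obtain u where "x \<star> y - skew_mod \<sigma> (x \<star> y) f = u \<star> f"
      using rdvd_minus_skew_mod[OF assms] unfolding skew_right_dvd_def by blast
    then have "\<phi> x \<star> \<phi> y - \<phi> (skew_mod \<sigma> (x \<star> y) f) = \<phi> u \<star> \<phi> f"
      by (metis phi_diff phi_mult)
    then show "\<phi> f rdvd \<phi> x \<star> \<phi> y - \<phi> (skew_mod \<sigma> (x \<star> y) f)"
      unfolding skew_right_dvd_def by blast
    show "\<phi> (skew_mod \<sigma> (x \<star> y) f) = 0 \<or> degree (\<phi> (skew_mod \<sigma> (x \<star> y) f)) < degree (\<phi> f)"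
      using degree_skew_mod[OF assms] by simp
  qed
  have "skew_semifield \<sigma> f = (V, \<lambda>a b. skew_mod \<sigma> (a \<star> b) f)"
    "skew_semifield \<sigma> (\<phi> f) = (V, \<lambda>a b. skew_mod \<sigma> (a \<star> b) (\<phi> f))"
    by (simp_all add: skew_semifield_def V_def)
  moreover have "additive_on V \<phi>" by (simp add: additive_on_def phi_add)
  ultimately show ?thesis
    using bij hom by (intro isotopicI[where F = \<phi> and G = \<phi> and H = \<phi>]) simp_all
qed

end

section \<open>Automorphisms of finite fields\<close>

text \<open>
The common source of \<open>sigma_eq_power\<close>, \<open>field_norm_omega\<close> and \<open>extend_automorphism\<close>. The product of the
factors \<open>X - \<phi>\<^sup>k(x)\<close> for \<open>k < n\<close> is unchanged by \<open>\<phi>\<close>, since \<open>\<phi>\<close> permutes the factors cyclically.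
So its coefficients are fixed by \<open>\<phi>\<close>, hence by \<open>\<tau>\<close>, and \<open>\<tau>\<close> maps its root \<open>x\<close> to a root. The domain
\<open>K\<close> of \<open>\<tau>\<close> is a parameter because the lemma is applied both to automorphisms of the whole field and to an
automorphism of a subfield.
\<close>

lemma conjugate_if_fixes_fixed_field:
  fixes \<phi> \<tau> :: "'a::field \<Rightarrow> 'a"
  assumes \<phi>: "field_automorphism_on UNIV \<phi>" and n: "n > 0" and x: "(\<phi> ^^ n) x = x"
    and K: "\<And>a b. a \<in> K \<Longrightarrow> b \<in> K \<Longrightarrow> a + b \<in> K" "\<And>a b. a \<in> K \<Longrightarrow> b \<in> K \<Longrightarrow> a * b \<in> K"
    and xK: "x \<in> K" and \<tau>: "field_automorphism_on K \<tau>"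
    and fix_K: "fixed_field \<phi> \<subseteq> K" and fix_\<tau>: "\<And>c. c \<in> fixed_field \<phi> \<Longrightarrow> \<tau> c = c"
  shows "\<exists>k<n. \<tau> x = (\<phi> ^^ k) x"
proof -
  note hom = field_automorphism_on_UNIV_simps(1-3)[OF \<phi>]
    and hom0 = field_automorphism_on_UNIV_simps(4)[OF \<phi>]
  have hom_minus: "\<phi> (- a) = - \<phi> a" for a
    using hom(1)[of a "- a"] hom0 by (simp add: eq_neg_iff_add_eq_0 add.commute)
  define Q where "Q = (\<Prod>j<n. [:- (\<phi> ^^ j) x, 1:])"
  have "map_poly \<phi> (\<Prod>j<m. [:- (\<phi> ^^ j) x, 1:]) = (\<Prod>j<m. [:- (\<phi> ^^ Suc j) x, 1:])" for m
  proof (induction m)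
    case (Suc m)
    then show ?case
      by (simp only: prod.lessThan_Suc map_poly_hom_mult[OF hom0 hom(1,2)])
        (simp add: map_poly_pCons hom hom0 hom_minus)
  qed (simp add: hom)
  then have "map_poly \<phi> Q = (\<Prod>j<n. [:- (\<phi> ^^ Suc j) x, 1:])" by (simp add: Q_def)
  also have "\<dots> = Q"
  proof -
    obtain m where m: "n = Suc m" using n by (cases n) auto
    have "Q = [:- x, 1:] * (\<Prod>j<m. [:- (\<phi> ^^ Suc j) x, 1:])"
      unfolding Q_def m by (subst prod.lessThan_Suc_shift) simp
    moreover have "(\<Prod>j<n. [:- (\<phi> ^^ Suc j) x, 1:]) = (\<Prod>j<m. [:- (\<phi> ^^ Suc j) x, 1:]) * [:- x, 1:]"
      using x unfolding m by simp
    ultimately show ?thesis by simp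
  qed
  finally have "\<phi> (coeff Q i) = coeff Q i" for i
    by (metis coeff_map_poly hom0)
  then have coeff_fixed: "coeff Q i \<in> fixed_field \<phi>" for i by (simp add: fixed_field_def)
  have K01: "0 \<in> K" "1 \<in> K" using fix_K hom hom0 by (auto simp: fixed_field_def)
  have \<tau>_hom: "\<tau> (a + b) = \<tau> a + \<tau> b" "\<tau> (a * b) = \<tau> a * \<tau> b" if "a \<in> K" "b \<in> K" for a b
    using \<tau> that by (auto simp: field_automorphism_on_def)
  have \<tau>01: "\<tau> 0 = 0" "\<tau> 1 = 1" using fix_\<tau> hom hom0 by (auto simp: fixed_field_def)
  have pow: "x ^ i \<in> K \<and> \<tau> (x ^ i) = \<tau> x ^ i" for i
    by (induction i) (simp_all add: K01 \<tau>01 K xK \<tau>_hom)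
  have summand: "coeff Q i * x ^ i \<in> K \<and> \<tau> (coeff Q i * x ^ i) = coeff Q i * \<tau> x ^ i" for i
    using coeff_fixed[of i] fix_K fix_\<tau>[of "coeff Q i"] pow[of i] \<tau>_hom K by auto
  have "(\<Sum>i\<le>m. coeff Q i * x ^ i) \<in> K \<and>
      \<tau> (\<Sum>i\<le>m. coeff Q i * x ^ i) = (\<Sum>i\<le>m. coeff Q i * \<tau> x ^ i)" for m
    by (induction m) (simp_all only: sum.atMost_Suc atMost_0 sum.insert finite.emptyI empty_iff
        sum.empty add_0_right summand K \<tau>_hom simp_thms)
  then have "\<tau> (poly Q x) = poly Q (\<tau> x)" by (simp add: poly_altdef)
  moreover have "poly Q x = 0" using n by (auto simp: Q_def poly_prod intro!: bexI[of _ 0])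
  ultimately have "poly Q (\<tau> x) = 0" using \<tau>01 by simp
  then show ?thesis by (auto simp: Q_def poly_prod)
qed

text \<open>
Multiplication by a nonzero \<open>x\<close> permutes the nonzero elements of \<open>K\<close>, so their product absorbs the factor
\<open>x\<^bsup>|K| - 1\<^esup>\<close>.
\<close>

lemma power_card_of_finite_subfield:
  fixes K :: "'a::field set"
  assumes "finite K" "0 \<in> K" "\<And>a b. a \<in> K \<Longrightarrow> b \<in> K \<Longrightarrow> a * b \<in> K" "\<And>a. a \<in> K \<Longrightarrow> inverse a \<in> K"
    and x: "x \<in> K"
  shows "x ^ card K = x"
proof (cases "x = 0")
  case True
  then show ?thesis using assms card_gt_0_iff[of K] by auto
next
  case False
  have "(\<Prod>y\<in>K-{0}. x * y) = (\<Prod>y\<in>K-{0}. y)"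
  proof (rule prod.reindex_bij_witness[of _ "\<lambda>y. inverse x * y" "\<lambda>y. x * y"])
  qed (use False assms in auto)
  then have "x ^ card (K - {0}) * (\<Prod>y\<in>K-{0}. y) = (\<Prod>y\<in>K-{0}. y)"
    by (simp add: prod.distrib)
  moreover have "(\<Prod>y\<in>K-{0}. y) \<noteq> 0" using assms by simp
  ultimately have "x ^ card (K - {0}) = 1" by simp
  moreover have "card K = Suc (card (K - {0}))" using assms by (metis card.remove)
  ultimately show ?thesis by simp
qed

text \<open>
The cyclicity of the multiplicative group of a field given by a carrier set, read for the carrier \<open>UNIV\<close>.
\<close>

lemma finite_field_generator:
  "\<exists>\<omega> :: 'a::{field,finite}. \<omega> \<noteq> 0 \<and> (\<forall>y. y \<noteq> 0 \<longrightarrow> (\<exists>i. y = \<omega> ^ i))"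
proof -
  define R :: "'a ring" where
    "R = \<lparr>carrier = UNIV, monoid.mult = (*), one = 1, zero = 0, add = (+)\<rparr>"
  interpret R: cring R
  proof (rule cringI)
    show "abelian_group R"
    proof (rule abelian_groupI)
      fix x assume "x \<in> carrier R"
      show "\<exists>y\<in>carrier R. y \<oplus>\<^bsub>R\<^esub> x = \<zero>\<^bsub>R\<^esub>"
        by (intro bexI[of _ "- x"]) (simp_all add: R_def)
    qed (simp_all add: R_def add_ac)
    show "comm_monoid R" by (rule comm_monoidI) (simp_all add: R_def mult_ac)
  qed (simp add: R_def distrib_right)
  interpret R: field R
  proof (rule R.cring_fieldI2)
    show "\<zero>\<^bsub>R\<^esub> \<noteq> \<one>\<^bsub>R\<^esub>" by (simp add: R_def)
    fix a assume "a \<in> carrier R" "a \<noteq> \<zero>\<^bsub>R\<^esub>"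
    then show "\<exists>b\<in>carrier R. a \<otimes>\<^bsub>R\<^esub> b = \<one>\<^bsub>R\<^esub>"
      by (intro bexI[of _ "inverse a"]) (simp_all add: R_def)
  qed
  have pow: "a [^]\<^bsub>R\<^esub> i = a ^ i" for a and i :: nat
    by (induction i) (simp_all add: R_def nat_pow_def mult.commute)
  have "finite (carrier R)" by (simp add: R_def)
  then obtain a where "a \<in> carrier (mult_of R)" "carrier (mult_of R) = {a [^]\<^bsub>R\<^esub> i | i::nat. i \<in> UNIV}"
    using R.finite_field_mult_group_has_gen by blast
  then have "a \<noteq> 0" "UNIV - {0} = {a ^ i | i. True}"
    by (simp_all add: pow mult_of_simps) (simp_all add: R_def)
  then show ?thesis by blast
qed

lemma finite_field_generator_order:
  assumes "\<omega> \<noteq> (0 :: 'a::{field,finite})" "\<And>y. y \<noteq> 0 \<Longrightarrow> \<exists>i. y = \<omega> ^ i"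
  defines "N \<equiv> card (UNIV :: 'a set) - 1"
  shows "\<omega> ^ N = 1" "inj_on (\<lambda>i. \<omega> ^ i) {..<N}"
proof -
  have cardN: "card (UNIV - {0 :: 'a}) = N" by (simp add: N_def card_Diff_singleton)
  have "card {0 :: 'a, 1} \<le> card (UNIV :: 'a set)" by (rule card_mono) auto
  then have N0: "N > 0" and NS: "card (UNIV :: 'a set) = Suc N" by (simp_all add: N_def)
  have "\<omega> ^ card (UNIV :: 'a set) = \<omega>" by (rule power_card_of_finite_subfield) auto
  then show 1: "\<omega> ^ N = 1" using assms(1) unfolding NS by simp
  have "(\<lambda>i. \<omega> ^ i) ` {..<N} = UNIV - {0}"
  proof
    show "UNIV - {0} \<subseteq> (\<lambda>i. \<omega> ^ i) ` {..<N}"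
    proof
      fix y :: 'a assume "y \<in> UNIV - {0}"
      then obtain i where "y = \<omega> ^ i" using assms(2) by auto
      also have "\<dots> = \<omega> ^ (N * (i div N) + i mod N)" by simp
      also have "\<dots> = \<omega> ^ (i mod N)" by (simp only: power_add power_mult 1 power_one mult_1)
      finally show "y \<in> (\<lambda>i. \<omega> ^ i) ` {..<N}" using N0 by auto
    qed
  qed (use assms(1) in auto)
  then show "inj_on (\<lambda>i. \<omega> ^ i) {..<N}"
    by (intro eq_card_imp_inj_on) (simp_all add: cardN)
qed

lemma card_power_fixpoints_le:
  assumes "q \<ge> 2"
  shows "finite {y :: 'a::field. y ^ q = y}" "card {y :: 'a::field. y ^ q = y} \<le> q"
proof -
  define P :: "'a poly" where "P = monom 1 q - monom 1 1"
  have "coeff P q = 1" using assms by (simp add: P_def)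
  then have "P \<noteq> 0" by auto
  have roots: "{y. y ^ q = y} = {y. poly P y = 0}" by (simp add: P_def poly_monom)
  have "degree P \<le> q" unfolding P_def using assms by (intro degree_diff_le) (simp_all add: degree_monom_eq)
  with \<open>P \<noteq> 0\<close> show "finite {y :: 'a::field. y ^ q = y}" "card {y :: 'a::field. y ^ q = y} \<le> q"
    unfolding roots using poly_roots_finite[of P] card_poly_roots_bound[of P] by auto
qed

lemma funpow_power: "((\<lambda>x :: 'a::monoid_mult. x ^ m) ^^ k) x = x ^ (m ^ k)"
  by (induction k) (simp_all flip: power_mult add: mult.commute)

lemma prime_CHAR_finite_field: "prime CHAR('a::{field,finite})"
  using finite_imp_CHAR_pos[where ?'a = 'a] prime_CHAR_semidom[where ?'a = 'a] by simp

lemma frobenius_automorphism: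
  "field_automorphism_on UNIV (\<lambda>x :: 'a::{field,finite}. x ^ (CHAR('a) ^ k))"
proof -
  let ?m = "CHAR('a) ^ k"
  have add: "(x + y) ^ ?m = x ^ ?m + y ^ ?m" for x y :: 'a
    by (rule freshmans_dream'[OF prime_CHAR_finite_field refl])
  have m: "?m > 0" using prime_gt_0_nat[OF prime_CHAR_finite_field[where ?'a = 'a]] by simp
  have "inj (\<lambda>x :: 'a. x ^ ?m)"
  proof (rule injI)
    fix x y :: 'a assume "x ^ ?m = y ^ ?m"
    then have "(x - y) ^ ?m = 0" using add[of "x - y" y] by simp
    then show "x = y" using m by simp
  qed
  then have "bij (\<lambda>x :: 'a. x ^ ?m)" by (simp add: bij_def finite_UNIV_inj_surj)
  then show ?thesis by (simp add: field_automorphism_on_def add power_mult_distrib)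
qed

text \<open>
The multiples of 1 give as many fixed points of the Frobenius map as its degree permits.
\<close>

lemma prime_field_eq: "{c :: 'a::{field,finite}. c ^ CHAR('a) = c} = range of_nat"
proof (rule sym, rule card_seteq)
  let ?p = "CHAR('a)"
  have p: "prime ?p" by (rule prime_CHAR_finite_field)
  then have p2: "?p \<ge> 2" by (rule prime_ge_2_nat)
  show "finite {c :: 'a. c ^ ?p = c}" by simp
  have "of_nat i ^ ?p = (of_nat i :: 'a)" for i
    using p2 by (induction i) (simp_all add: freshmans_dream[OF p refl] power_0_left)
  then show "range of_nat \<subseteq> {c :: 'a. c ^ ?p = c}" by auto
  have "inj_on (of_nat :: nat \<Rightarrow> 'a) {..<?p}"
    by (rule inj_onI) (auto simp: of_nat_eq_iff_cong_CHAR cong_def)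
  then have "card (of_nat ` {..<?p} :: 'a set) = ?p" by (simp add: card_image)
  moreover have "card (of_nat ` {..<?p} :: 'a set) \<le> card (range of_nat :: 'a set)"
    by (rule card_mono) auto
  ultimately show "card {c :: 'a. c ^ ?p = c} \<le> card (range of_nat :: 'a set)"
    using card_power_fixpoints_le(2)[OF p2, where ?'a = 'a] by simp
qed

lemma geometric_sum_nat: "(q - 1) * (\<Sum>j<n. q ^ j) = q ^ n - (1::nat)" if "q \<ge> 1"
proof (induction n)
  case (Suc n)
  have "q ^ n \<ge> 1" using that by simp
  then show ?case using Suc that by (simp add: algebra_simps diff_mult_distrib)
qed simp

locale finite_cyclic_extension = skew_polynomial_ring \<sigma>
  for \<sigma> :: "'a::{field,finite} \<Rightarrow> 'a" +
  fixes q n :: nat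
  assumes q: "primepow q" and card_L: "card (UNIV :: 'a set) = q ^ n"
    and card_F: "card (fixed_field \<sigma>) = q"
begin

abbreviation F :: "'a set" where "F \<equiv> fixed_field \<sigma>"

lemma prime_p: "prime CHAR('a)" by (rule prime_CHAR_finite_field)

lemma n_pos: "n > 0"
proof -
  have "card {0 :: 'a, 1} \<le> card (UNIV :: 'a set)" by (rule card_mono) auto
  then show ?thesis using card_L by (cases n) auto
qed

lemma q_power_of_p: "\<exists>e>0. q = CHAR('a) ^ e"
proof -
  obtain r e where re: "prime r" "e > 0" "q = r ^ e" using q by (auto simp: primepow_def)
  have "CHAR('a) dvd r ^ (e * n)" using CHAR_dvd_CARD[where ?'a = 'a] card_L re by (simp add: power_mult)
  then have "CHAR('a) = r" using prime_p re(1) by (metis prime_dvd_power primes_dvd_imp_eq)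
  then show ?thesis using re by blast
qed

lemma q_ge_2: "q \<ge> 2"
  using primepow_gt_Suc_0[OF q] by simp

lemma F_closed: "0 \<in> F" "1 \<in> F" "a \<in> F \<Longrightarrow> b \<in> F \<Longrightarrow> a + b \<in> F" "a \<in> F \<Longrightarrow> b \<in> F \<Longrightarrow> a * b \<in> F"
    "a \<in> F \<Longrightarrow> inverse a \<in> F"
proof -
  show "inverse a \<in> F" if "a \<in> F"
  proof (cases "a = 0")
    case False
    then have "\<sigma> (inverse a) * a = inverse a * a"
      using that sigma_simps(2)[of "inverse a" a] by (simp add: fixed_field_def)
    then have "\<sigma> (inverse a) = inverse a" using False by (metis mult_right_cancel)
    then show ?thesis by (simp add: fixed_field_def)
  qed (simp add: fixed_field_def)
qed (simp_all add: fixed_field_def)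

text \<open>
Both sides have \<open>q\<close> elements, so that \<open>x \<mapsto> x\<^sup>q\<close> has the same fixed field as \<open>\<sigma>\<close>.
\<close>

lemma F_eq: "F = {y. y ^ q = y}"
proof (rule card_seteq)
  show "F \<subseteq> {y. y ^ q = y}"
    using power_card_of_finite_subfield[of F] F_closed by (auto simp: card_F)
  show "card {y :: 'a. y ^ q = y} \<le> card F"
    using card_power_fixpoints_le[OF q_ge_2, where ?'a = 'a] by (simp add: card_F)
qed simp

lemma power_q_automorphism: "field_automorphism_on UNIV (\<lambda>x :: 'a. x ^ (q ^ j))"
  using q_power_of_p frobenius_automorphism by (metis power_mult)

lemma F_power_q: "c \<in> F \<Longrightarrow> c ^ (q ^ j) = c"
  by (induction j) (simp_all add: F_eq power_mult)

definition \<omega> :: 'a where "\<omega> = (SOME x. x \<noteq> 0 \<and> (\<forall>y. y \<noteq> 0 \<longrightarrow> (\<exists>i. y = x ^ i)))"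

lemma omega: "\<omega> \<noteq> 0" "y \<noteq> 0 \<Longrightarrow> \<exists>i. y = \<omega> ^ i"
  using someI_ex[OF finite_field_generator] unfolding \<omega>_def by blast+

lemma sigma_power_power: "(\<sigma> ^^ i) (x ^ s) = (\<sigma> ^^ i) x ^ s"
  by (induction s) simp_all

lemma omega_order: "\<omega> ^ (q ^ n - 1) = 1" "inj_on (\<lambda>i. \<omega> ^ i) {..<q ^ n - 1}"
  using finite_field_generator_order[OF omega] by (simp_all add: card_L)

lemma omega_power_inj: "\<omega> ^ i = \<omega> ^ j \<Longrightarrow> i \<in> {1..q ^ n - 1} \<Longrightarrow> j \<in> {1..q ^ n - 1} \<Longrightarrow> i = j"
  using omega_order(2) omega(1)
  by (cases i; cases j) (auto dest: inj_onD)

lemma power_card_L: "x ^ (q ^ n) = (x :: 'a)"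
  using power_card_of_finite_subfield[of "UNIV :: 'a set" x] by (simp add: card_L)

text \<open>
Since \<open>\<sigma>\<close> fixes the fixed points of \<open>x \<mapsto> x\<^sup>q\<close>, it sends the generator \<open>\<omega>\<close> to one of the iterated \<open>q\<close>-th
powers of \<open>\<omega>\<close>; the image of \<open>\<omega>\<close> determines \<open>\<sigma>\<close>.
\<close>

lemma sigma_eq_power: "\<exists>k. \<forall>y. \<sigma> y = y ^ (q ^ k)"
proof -
  have "\<exists>k<n. \<sigma> \<omega> = ((\<lambda>x. x ^ q) ^^ k) \<omega>"
  proof (rule conjugate_if_fixes_fixed_field[where K = UNIV])
    show "field_automorphism_on UNIV (\<lambda>x :: 'a. x ^ q)" using power_q_automorphism[of 1] by simp
    show "((\<lambda>x. x ^ q) ^^ n) \<omega> = \<omega>" by (simp add: funpow_power power_card_L)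
    fix c assume "c \<in> fixed_field (\<lambda>x :: 'a. x ^ q)"
    then show "\<sigma> c = c" using F_eq by (auto simp: fixed_field_def)
  qed (use automorphism n_pos in auto)
  then obtain k where k: "\<sigma> \<omega> = \<omega> ^ (q ^ k)" by (auto simp: funpow_power)
  have "\<sigma> y = y ^ (q ^ k)" for y
  proof (cases "y = 0")
    case False
    then obtain i where "y = \<omega> ^ i" using omega by blast
    then show ?thesis using sigma_power_power[of 1 \<omega> i] k by (simp flip: power_mult add: mult.commute)
  qed (use q_ge_2 in \<open>simp add: power_0_left\<close>)
  then show ?thesis by blast
qed

lemma sigma_power_n: "(\<sigma> ^^ n) x = x"
proof -
  obtain k where k: "\<And>y. \<sigma> y = y ^ (q ^ k)" using sigma_eq_power by blast
  then have "\<sigma> = (\<lambda>y. y ^ (q ^ k))" by auto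
  then have "(\<sigma> ^^ n) x = x ^ ((q ^ n) ^ k)" by (simp add: funpow_power flip: power_mult) (simp add: mult.commute)
  also have "\<dots> = ((\<lambda>x. x ^ (q ^ n)) ^^ k) x" by (simp add: funpow_power)
  also have "\<dots> = x" by (induction k) (simp_all add: power_card_L)
  finally show ?thesis .
qed

definition field_norm :: "'a \<Rightarrow> 'a" where "field_norm x = (\<Prod>i<n. (\<sigma> ^^ i) x)"

text \<open>
With the roles of \<open>\<sigma>\<close> and \<open>x \<mapsto> x\<^sup>q\<close> exchanged, each iterated \<open>q\<close>-th power of \<open>\<omega>\<close> is a conjugate
\<open>\<sigma>\<^sup>i(\<omega>)\<close>. There are \<open>n\<close> such powers, so these are all the conjugates, each once, and the norm is their
product.
\<close>

lemma field_norm_omega: "field_norm \<omega> = \<omega> ^ (\<Sum>j<n. q ^ j)"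
proof -
  let ?A = "(\<lambda>j. \<omega> ^ (q ^ j)) ` {..<n}" and ?B = "(\<lambda>i. (\<sigma> ^^ i) \<omega>) ` {..<n}"
  have "\<omega> ^ (q ^ j) \<in> ?B" for j
  proof -
    have "\<exists>k<n. \<omega> ^ (q ^ j) = (\<sigma> ^^ k) \<omega>"
      by (rule conjugate_if_fixes_fixed_field[where K = UNIV])
        (use automorphism n_pos power_q_automorphism F_power_q sigma_power_n in auto)
    then show ?thesis by blast
  qed
  then have sub: "?A \<subseteq> ?B" by auto
  have injA: "inj_on (\<lambda>j. \<omega> ^ (q ^ j)) {..<n}"
  proof (rule inj_onI)
    fix i j assume ij: "i \<in> {..<n}" "j \<in> {..<n}" "\<omega> ^ (q ^ i) = \<omega> ^ (q ^ j)"
    have "q ^ k \<in> {1..q ^ n - 1}" if "k \<in> {..<n}" for k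
    proof -
      have "q ^ k < q ^ n" using that q_ge_2 by (intro power_strict_increasing) auto
      moreover have "q ^ k > 0" using q_ge_2 by simp
      ultimately show ?thesis by auto
    qed
    then have "q ^ i = q ^ j" using omega_power_inj ij by blast
    then show "i = j" using q_ge_2 by (simp add: power_inject_exp)
  qed
  then have cardA: "card ?A = n" by (simp add: card_image)
  have cardB: "card ?B \<le> n" using card_image_le[of "{..<n}"] by force
  have eq: "?A = ?B" by (rule card_seteq) (use sub cardA cardB in auto)
  then have injB: "inj_on (\<lambda>i. (\<sigma> ^^ i) \<omega>) {..<n}" using cardA by (intro eq_card_imp_inj_on) auto
  have "field_norm \<omega> = \<Prod>?B" by (simp add: field_norm_def prod.reindex[OF injB])
  also have "\<dots> = \<Prod>?A" by (simp add: eq)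
  also have "\<dots> = (\<Prod>j<n. \<omega> ^ (q ^ j))" by (simp add: prod.reindex[OF injA])
  also have "\<dots> = \<omega> ^ (\<Sum>j<n. q ^ j)" by (simp add: power_sum)
  finally show ?thesis .
qed

text \<open>
The exponent \<open>S = 1 + q + \<dots> + q\<^sup>n\<^sup>-\<^sup>1\<close> satisfies \<open>(q - 1) S = q\<^sup>n - 1\<close>, the order of \<open>\<omega>\<close>. So
the norm of \<open>\<omega>\<close> has order \<open>q - 1\<close> and generates the multiplicative group of \<open>F\<close>.
\<close>

lemma field_norm_omega_generates: "y \<in> F \<Longrightarrow> y \<noteq> 0 \<Longrightarrow> \<exists>s. y = field_norm \<omega> ^ s"
  and field_norm_omega_in_F: "field_norm \<omega> \<in> F"
proof -
  let ?S = "\<Sum>j<n. q ^ j"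
  have S: "(q - 1) * ?S = q ^ n - 1" using geometric_sum_nat q_ge_2 by simp
  have Spos: "?S > 0" using n_pos q_ge_2 by (intro sum_pos) auto
  have pow1: "field_norm \<omega> ^ (q - 1) = 1"
    by (metis field_norm_omega omega_order(1) S mult.commute power_mult)
  have "field_norm \<omega> ^ q = field_norm \<omega> ^ Suc (q - 1)" using q_ge_2 by simp
  then show NF: "field_norm \<omega> \<in> F" using pow1 by (simp add: F_eq)
  have inj: "inj_on (\<lambda>s. field_norm \<omega> ^ s) {..<q - 1}"
  proof (rule inj_onI)
    fix i j assume ij: "i \<in> {..<q - 1}" "j \<in> {..<q - 1}" "field_norm \<omega> ^ i = field_norm \<omega> ^ j"
    have "?S * k < q ^ n - 1" if "k \<in> {..<q - 1}" for k
    proof -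
      have "?S * k < ?S * (q - 1)" using that Spos by simp
      then show ?thesis using S by (simp only: mult.commute)
    qed
    then have "?S * i = ?S * j"
      using ij inj_onD[OF omega_order(2), of "?S * i" "?S * j"] by (simp add: field_norm_omega power_mult)
    then show "i = j" using Spos by (metis mult_left_cancel less_irrefl)
  qed
  have "(\<lambda>s. field_norm \<omega> ^ s) ` {..<q - 1} = F - {0}"
  proof (rule card_seteq)
    have "field_norm \<omega> ^ s \<in> F" for s by (induction s) (simp_all add: F_closed NF)
    then show "(\<lambda>s. field_norm \<omega> ^ s) ` {..<q - 1} \<subseteq> F - {0}" using omega by (auto simp: field_norm_omega)
    show "card (F - {0}) \<le> card ((\<lambda>s. field_norm \<omega> ^ s) ` {..<q - 1})"
      using card_image[OF inj] by (simp add: card_F F_closed card_Diff_singleton)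
  qed simp
  then show "\<exists>s. y = field_norm \<omega> ^ s" if "y \<in> F" "y \<noteq> 0"
    using that by blast
qed

lemma field_norm_surjective:
  assumes "y \<in> F" "y \<noteq> 0"
  shows "\<exists>\<mu>. \<mu> \<noteq> 0 \<and> field_norm \<mu> = y"
proof -
  obtain s where "y = field_norm \<omega> ^ s" using field_norm_omega_generates assms by blast
  then have "field_norm (\<omega> ^ s) = y" by (simp add: field_norm_def sigma_power_power prod_power_distrib)
  then show ?thesis using omega by (intro exI[of _ "\<omega> ^ s"]) simp
qed

text \<open>
The automorphism \<open>\<rho>\<close> fixes the prime field, so it sends a generator of \<open>F\<close> to one of its conjugates under
the Frobenius map and thus agrees with a power of that map. The same power makes sense on \<open>L\<close>, and it
commutes with \<open>\<sigma>\<close> because \<open>\<sigma>\<close> is multiplicative.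
\<close>

lemma extend_automorphism:
  assumes \<rho>: "field_automorphism_on F \<rho>"
  shows "\<exists>\<tau>. field_automorphism_on UNIV \<tau> \<and> (\<forall>x. \<tau> (\<sigma> x) = \<sigma> (\<tau> x)) \<and> (\<forall>y\<in>F. \<tau> y = \<rho> y)"
proof -
  have hom: "\<rho> (a + b) = \<rho> a + \<rho> b" "\<rho> (a * b) = \<rho> a * \<rho> b" "\<rho> 1 = 1" if "a \<in> F" "b \<in> F" for a b
    using \<rho> that by (auto simp: field_automorphism_on_def)
  have \<rho>0: "\<rho> 0 = 0" using hom(1)[of 0 0] F_closed by (metis add_cancel_right_left add_0)
  have \<rho>1: "\<rho> 1 = 1" using hom F_closed by blast
  obtain e where e: "e > 0" "q = CHAR('a) ^ e" using q_power_of_p by blast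
  have of_nat: "of_nat i \<in> F \<and> \<rho> (of_nat i) = of_nat i" for i
    by (induction i) (simp_all add: F_closed \<rho>0 \<rho>1 hom)
  have fixed: "fixed_field (\<lambda>x :: 'a. x ^ CHAR('a)) = range of_nat"
    using prime_field_eq[where ?'a = 'a] by (simp add: fixed_field_def)
  let ?g = "field_norm \<omega>"
  have "\<exists>k<e. \<rho> ?g = ((\<lambda>x. x ^ CHAR('a)) ^^ k) ?g"
  proof (rule conjugate_if_fixes_fixed_field[where K = F])
    show "field_automorphism_on UNIV (\<lambda>x :: 'a. x ^ CHAR('a))" using frobenius_automorphism[of 1] by simp
    show "((\<lambda>x. x ^ CHAR('a)) ^^ e) ?g = ?g" using field_norm_omega_in_F by (simp add: funpow_power F_eq flip: e(2))
    show "fixed_field (\<lambda>x :: 'a. x ^ CHAR('a)) \<subseteq> F" unfolding fixed using of_nat by blast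
    show "\<rho> c = c" if "c \<in> fixed_field (\<lambda>x :: 'a. x ^ CHAR('a))" for c
      using that of_nat unfolding fixed by blast
  qed (fact e(1) F_closed \<rho> field_norm_omega_in_F)+
  then obtain k where k: "\<rho> ?g = ?g ^ (CHAR('a) ^ k)" by (auto simp: funpow_power)
  let ?\<tau> = "\<lambda>x :: 'a. x ^ (CHAR('a) ^ k)"
  have "?\<tau> y = \<rho> y" if y: "y \<in> F" for y
  proof (cases "y = 0")
    case True
    then show ?thesis using \<rho>0 prime_gt_0_nat[OF prime_p] by (simp add: power_0_left)
  next
    case False
    then obtain s where s: "y = ?g ^ s" using field_norm_omega_generates y by blast
    have "?g ^ s \<in> F \<and> \<rho> (?g ^ s) = \<rho> ?g ^ s" for s
      by (induction s) (simp_all add: F_closed field_norm_omega_in_F \<rho>1 hom)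
    then show ?thesis by (simp add: s k mult.commute flip: power_mult)
  qed
  moreover have "?\<tau> (\<sigma> x) = \<sigma> (?\<tau> x)" for x using sigma_power_power[of 1 x] by simp
  ultimately show ?thesis
    by (intro exI[of _ ?\<tau>]) (simp add: frobenius_automorphism)
qed

end

section \<open>Isotopy of the semifields\<close>

lemma coeff_eval_t_power:
  assumes "n > 0"
  shows "coeff (eval_t_power n h) k = (if n dvd k then coeff h (k div n) else 0)"
proof -
  have "coeff (eval_t_power n h) k = (\<Sum>i\<le>degree h. if i = k div n \<and> n dvd k then coeff h i else 0)"
    unfolding eval_t_power_def coeff_sum using assms by (intro sum.cong) auto
  then show ?thesis by (auto simp: not_le coeff_eq_0)
qed

theorem theorem11:
  fixes \<sigma> \<rho> :: "'a::{field,finite} \<Rightarrow> 'a"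
    and f g fhat ghat :: "'a poly"
    and lam :: 'a
    and q n d :: nat
  assumes "primepow q"
    and "card (UNIV :: 'a set) = q ^ n"
    and "field_automorphism_on UNIV \<sigma>"
    and "card (fixed_field \<sigma>) = q"
    and "skew_irreducible \<sigma> f" and "degree f = d"
    and "skew_irreducible \<sigma> g" and "degree g = d"
    and "fhat \<in> polys_over (fixed_field \<sigma>)" and "is_mzlm \<sigma> f (eval_t_power n fhat)"
    and "ghat \<in> polys_over (fixed_field \<sigma>)" and "is_mzlm \<sigma> g (eval_t_power n ghat)"
    and "lam \<in> fixed_field \<sigma>" and "lam \<noteq> 0"
    and "field_automorphism_on (fixed_field \<sigma>) \<rho>"
    and "ghat = smult (inverse lam ^ d) (pcompose (map_poly \<rho> fhat) [:0, lam:])"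
  shows "isotopic (skew_semifield \<sigma> f) (skew_semifield \<sigma> g)"
proof -
  interpret finite_cyclic_extension \<sigma> q n using assms by unfold_locales
  obtain \<tau> where \<tau>: "field_automorphism_on UNIV \<tau>" "\<And>x. \<tau> (\<sigma> x) = \<sigma> (\<tau> x)"
      "\<And>y. y \<in> fixed_field \<sigma> \<Longrightarrow> \<tau> y = \<rho> y"
    using extend_automorphism assms(15) by blast
  obtain \<mu> where \<mu>: "\<mu> \<noteq> 0" "field_norm \<mu> = lam"
    using field_norm_surjective assms(13,14) by blast
  interpret skew_ring_automorphism \<sigma> \<tau> \<mu>
    using \<tau> \<mu> by unfold_locales auto
  (* (\<mu> t)^n = lam t^n, where lam is fixed by \<sigma> *)
  have norm_power: "partial_norm (n * i) = lam ^ i" for i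
  proof (induction i)
    case (Suc i)
    have "partial_norm n = lam" using \<mu>(2) by (simp add: partial_norm_def field_norm_def)
    then show ?case using Suc partial_norm_add[of n "n * i"] by (simp add: sigma_power_n)
  qed (simp add: partial_norm_def)
  have \<rho>0: "\<rho> 0 = 0" using \<tau>(3)[of 0] by (simp add: fixed_field_def)
  have \<tau>\<rho>: "\<tau> (coeff fhat i) = \<rho> (coeff fhat i)" for i
    using assms(9) \<tau>(3) by (simp add: polys_over_def)
  have "eval_t_power n ghat = smult (inverse lam ^ d) (\<phi> (eval_t_power n fhat))"
  proof (rule poly_eqI)
    fix k
    show "coeff (eval_t_power n ghat) k = coeff (smult (inverse lam ^ d) (\<phi> (eval_t_power n fhat))) k"
      unfolding assms(16) using n_pos \<rho>0
      by (auto simp: coeff_phi coeff_eval_t_power norm_power coeff_pcompose_linear coeff_map_poly \<tau>\<rho>)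
  qed
  moreover obtain u where "eval_t_power n fhat = u \<star> f"
    using assms(10) by (auto simp: is_mzlm_def skew_right_dvd_def)
  ultimately have "eval_t_power n ghat = smult (inverse lam ^ d) (\<phi> u) \<star> \<phi> f"
    by (simp add: phi_mult smult_skew_mult)
  then have dvd: "\<phi> f rdvd eval_t_power n ghat" unfolding skew_right_dvd_def by blast
  have \<phi>f: "skew_irreducible \<sigma> (\<phi> f)" using assms(5) by (rule phi_irreducible)
  have "isotopic (skew_semifield \<sigma> f) (skew_semifield \<sigma> (\<phi> f))"
    using assms(5) by (intro isotopic_phi) (auto simp: skew_irreducible_def)
  moreover have "isotopic (skew_semifield \<sigma> (\<phi> f)) (skew_semifield \<sigma> g)"
    by (rule isotopic_if_common_central_multiple[OF _ \<phi>f assms(7) _ assms(12) dvd])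
      (simp_all add: assms)
  ultimately show ?thesis by (rule isotopic_trans)
qed

end
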